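(* The following are equivalent for a (classical) normed real vector space $V$: (i) the additive normed group of $V$, considered as a one-object normed category, is Cauchy cocomplete; (ii) every series $\sum_n a_n$ in $V$ satisfying the Cauchy criterion converges in $V$; (iii) $V$ is a Banach space.
   Context: A classical normed vector space has a norm $\|\cdot\|$ with finite values satisfying the usual axioms, including separation. Its additive group $(V,+)$ is regarded as a normed category with a single object, with morphisms the vectors, composition the vector addition, and norm $|a|=\|a\|$. The series $\sum_n a_n$ satisfies the Cauchy criterion if for every $\varepsilon>0$ there is $N$ such that $\|\sum_{i=m}^{n-1}a_i\|\le\varepsilon$ for all $n\ge m\ge N$. Convergence of a series is with respect to the metric induced by the norm. A normed category is a category $\mathbb X$ with a value $|f|\in[0,\infty]$ for every morphism $f$ such that $|1_x|=0$ and $|g\cdot f|\le|f|+|g|$ for all objects $x$ and composable $f,g$. A sequence in $\mathbb X$ is a functor $s:\mathbb N\to\mathbb X$ from the ordered set $\mathbb N$, written $s=(s_{m,n}:x_m\to x_n)_{m\le n}$. It is Cauchy if $\inf_{N}\sup_{n\ge m\ge N}|s_{m,n}|=0$. A normed colimit of $s$ is an object $x$ with a cocone $\gamma=(\gamma_n:x_n\to x)_n$ which is a colimit cocone of $s$ in the ordinary category $\mathbb X$ such that, for every morphism $f$ with domain $x$, $|f|=\inf_{N}\sup_{n\ge N}|f\cdot\gamma_n|$. $\mathbb X$ is Cauchy cocomplete if every Cauchy sequence in $\mathbb X$ has a normed colimit in $\mathbb X$. *)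

theory Defs
  imports Complex_Main "HOL-Library.Extended_Nonnegative_Real"
begin

text \<open>
  Categories are given by explicit carriers of objects and arrows; the operations are only
  meaningful on these carriers. \<open>Comp C g f\<close> is \<open>g \<cdot> f\<close> (first \<open>f\<close>, then \<open>g\<close>), and \<open>Nrm\<close> takes
  values in \<open>[0, \<infinity>]\<close>.
\<close>

record ('o, 'm) normed_cat =
  Obj :: "'o set"
  Arr :: "'m set"
  Dom :: "'m \<Rightarrow> 'o"
  Cod :: "'m \<Rightarrow> 'o"
  Idt :: "'o \<Rightarrow> 'm"
  Comp :: "'m \<Rightarrow> 'm \<Rightarrow> 'm"
  Nrm :: "'m \<Rightarrow> ennreal"

definition Hom :: "('o, 'm) normed_cat \<Rightarrow> 'o \<Rightarrow> 'o \<Rightarrow> 'm set" where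
  "Hom C x y = {f \<in> Arr C. Dom C f = x \<and> Cod C f = y}"

locale normed_category =
  fixes C :: "('o, 'm) normed_cat"
  assumes Dom_in_Obj: "f \<in> Arr C \<Longrightarrow> Dom C f \<in> Obj C"
    and Cod_in_Obj: "f \<in> Arr C \<Longrightarrow> Cod C f \<in> Obj C"
    and Idt_in_Hom: "x \<in> Obj C \<Longrightarrow> Idt C x \<in> Hom C x x"
    and Comp_in_Hom: "f \<in> Hom C x y \<Longrightarrow> g \<in> Hom C y z \<Longrightarrow> Comp C g f \<in> Hom C x z"
    and Comp_Idt: "f \<in> Hom C x y \<Longrightarrow> Comp C f (Idt C x) = f"
    and Idt_Comp: "f \<in> Hom C x y \<Longrightarrow> Comp C (Idt C y) f = f"
    and Comp_assoc: "f \<in> Hom C w x \<Longrightarrow> g \<in> Hom C x y \<Longrightarrow> h \<in> Hom C y z \<Longrightarrow>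
      Comp C h (Comp C g f) = Comp C (Comp C h g) f"
    and Nrm_Idt: "x \<in> Obj C \<Longrightarrow> Nrm C (Idt C x) = 0"
    and Nrm_Comp: "f \<in> Hom C x y \<Longrightarrow> g \<in> Hom C y z \<Longrightarrow>
      Nrm C (Comp C g f) \<le> Nrm C f + Nrm C g"

text \<open>
  A functor from the ordered set of natural numbers, with object part \<open>X\<close> and arrow part \<open>s\<close>;
  the values \<open>s m n\<close> with \<open>m > n\<close> are irrelevant.
\<close>

definition is_sequence ::
  "('o, 'm) normed_cat \<Rightarrow> (nat \<Rightarrow> 'o) \<Rightarrow> (nat \<Rightarrow> nat \<Rightarrow> 'm) \<Rightarrow> bool" where
  "is_sequence C X s \<longleftrightarrow>
     (\<forall>n. X n \<in> Obj C) \<and>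
     (\<forall>m n. m \<le> n \<longrightarrow> s m n \<in> Hom C (X m) (X n)) \<and>
     (\<forall>n. s n n = Idt C (X n)) \<and>
     (\<forall>k m n. k \<le> m \<longrightarrow> m \<le> n \<longrightarrow> Comp C (s m n) (s k m) = s k n)"

definition cauchy_sequence ::
  "('o, 'm) normed_cat \<Rightarrow> (nat \<Rightarrow> 'o) \<Rightarrow> (nat \<Rightarrow> nat \<Rightarrow> 'm) \<Rightarrow> bool" where
  "cauchy_sequence C X s \<longleftrightarrow>
     is_sequence C X s \<and>
     (INF N. SUP (m, n) \<in> {(m, n). N \<le> m \<and> m \<le> n}. Nrm C (s m n)) = 0"

definition is_cocone ::
  "('o, 'm) normed_cat \<Rightarrow> (nat \<Rightarrow> 'o) \<Rightarrow> (nat \<Rightarrow> nat \<Rightarrow> 'm) \<Rightarrow> 'o \<Rightarrow> (nat \<Rightarrow> 'm) \<Rightarrow> bool" where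
  "is_cocone C X s x \<gamma> \<longleftrightarrow>
     x \<in> Obj C \<and>
     (\<forall>n. \<gamma> n \<in> Hom C (X n) x) \<and>
     (\<forall>m n. m \<le> n \<longrightarrow> Comp C (\<gamma> n) (s m n) = \<gamma> m)"

definition is_colimit ::
  "('o, 'm) normed_cat \<Rightarrow> (nat \<Rightarrow> 'o) \<Rightarrow> (nat \<Rightarrow> nat \<Rightarrow> 'm) \<Rightarrow> 'o \<Rightarrow> (nat \<Rightarrow> 'm) \<Rightarrow> bool" where
  "is_colimit C X s x \<gamma> \<longleftrightarrow>
     is_cocone C X s x \<gamma> \<and>
     (\<forall>y \<delta>. is_cocone C X s y \<delta> \<longrightarrow>
        (\<exists>!f. f \<in> Hom C x y \<and> (\<forall>n. Comp C f (\<gamma> n) = \<delta> n)))"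

definition is_normed_colimit ::
  "('o, 'm) normed_cat \<Rightarrow> (nat \<Rightarrow> 'o) \<Rightarrow> (nat \<Rightarrow> nat \<Rightarrow> 'm) \<Rightarrow> 'o \<Rightarrow> (nat \<Rightarrow> 'm) \<Rightarrow> bool" where
  "is_normed_colimit C X s x \<gamma> \<longleftrightarrow>
     is_colimit C X s x \<gamma> \<and>
     (\<forall>f \<in> Arr C. Dom C f = x \<longrightarrow>
        Nrm C f = (INF N. SUP n \<in> {N..}. Nrm C (Comp C f (\<gamma> n))))"

definition cauchy_cocomplete :: "('o, 'm) normed_cat \<Rightarrow> bool" where
  "cauchy_cocomplete C \<longleftrightarrow>
     (\<forall>X s. cauchy_sequence C X s \<longrightarrow> (\<exists>x \<gamma>. is_normed_colimit C X s x \<gamma>))"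

definition additive_normed_cat :: "(unit, 'a::real_normed_vector) normed_cat" where
  "additive_normed_cat =
     \<lparr>Obj = UNIV, Arr = UNIV, Dom = (\<lambda>_. ()), Cod = (\<lambda>_. ()), Idt = (\<lambda>_. 0),
      Comp = (\<lambda>b a. b + a), Nrm = (\<lambda>a. ennreal (norm a))\<rparr>"

lemma normed_category_additive: "normed_category additive_normed_cat"
  by unfold_locales
    (auto simp: additive_normed_cat_def Hom_def add.assoc norm_triangle_ineq add.commute
      simp flip: ennreal_plus intro!: ennreal_leI order.trans[OF norm_triangle_ineq])

definition cauchy_criterion :: "(nat \<Rightarrow> 'a::real_normed_vector) \<Rightarrow> bool" where
  "cauchy_criterion a \<longleftrightarrow>
     (\<forall>\<epsilon>>0. \<exists>N. \<forall>m n. N \<le> m \<longrightarrow> m \<le> n \<longrightarrow> norm (\<Sum>i=m..<n. a i) \<le> \<epsilon>)"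

end

theory Submission
  imports Defs
begin

text \<open>
  In the additive category a sequence is determined by its partial compositions \<open>S n = s 0 n\<close>,
  via \<open>s m n = S n - S m\<close>, and it is Cauchy iff \<open>S\<close> is a Cauchy sequence of vectors. Because all
  morphisms are invertible, every cocone, necessarily of the form \<open>\<gamma> n = \<gamma> 0 - S n\<close>, is a colimit
  cocone. The norm condition at \<open>f = 0\<close> says that \<open>\<gamma>\<close> tends to \<open>0\<close>, that is, that \<open>S\<close> converges
  to \<open>\<gamma> 0\<close>, and conversely \<open>\<gamma> \<longlonglongrightarrow> 0\<close> gives the norm condition at every \<open>f\<close> by continuity of the
  norm.
\<close>

text \<open>Serves both infima of suprema in the definitions: \<open>A N\<close> is the set of pairs
  with \<open>N \<le> m \<le> n\<close> for Cauchy sequences, and the tail \<open>{N..}\<close> for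
  normed colimits.\<close>

lemma INF_SUP_eq_0_iff:
  fixes f :: "'b \<Rightarrow> ennreal"
  shows "(INF N. SUP p \<in> A N. f p) = 0 \<longleftrightarrow> (\<forall>e>0. \<exists>N. \<forall>p \<in> A N. f p \<le> ennreal e)"
    (is "?I = 0 \<longleftrightarrow> ?R")
proof
  assume I: "?I = 0"
  show ?R
  proof (intro allI impI)
    fix e :: real
    assume "e > 0"
    then have "?I < ennreal e" using I by simp
    then obtain N where "(SUP p \<in> A N. f p) < ennreal e"
      by (auto simp: INF_less_iff)
    then show "\<exists>N. \<forall>p \<in> A N. f p \<le> ennreal e"
      by (meson SUP_upper less_imp_le order_trans)
  qed
next
  assume R: ?R
  have "?I \<le> 0"
  proof (rule ennreal_le_epsilon)
    fix e :: real
    assume "e > 0"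
    then obtain N where "\<forall>p \<in> A N. f p \<le> ennreal e" using R by blast
    then have "(SUP p \<in> A N. f p) \<le> ennreal e" by (simp add: SUP_le_iff)
    then have "?I \<le> ennreal e" by (rule INF_lower2[OF UNIV_I])
    then show "?I \<le> 0 + ennreal e" by simp
  qed
  then show "?I = 0" by simp
qed

text \<open>Ordered indices and a non-strict bound are the form in which both
  \<open>cauchy_criterion\<close> and \<open>cauchy_sequence\<close> express the Cauchy
  property.\<close>

lemma Cauchy_iff_norm_diff_le:
  fixes S :: "nat \<Rightarrow> 'a::real_normed_vector"
  shows "Cauchy S \<longleftrightarrow> (\<forall>e>0. \<exists>N. \<forall>m n. N \<le> m \<longrightarrow> m \<le> n \<longrightarrow> norm (S n - S m) \<le> e)"
    (is "_ \<longleftrightarrow> ?R")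
proof
  assume "Cauchy S"
  then show ?R
    by (meson CauchyD less_imp_le order_trans)
next
  assume R: ?R
  show "Cauchy S"
  proof (rule CauchyI)
    fix e :: real
    assume "e > 0"
    \<comment> \<open>Halving \<open>e\<close> turns the non-strict bound into the strict one
      required.\<close>
    with R[rule_format, of "e / 2"] obtain N
      where N: "norm (S n - S m) \<le> e / 2" if "N \<le> m" "m \<le> n" for m n
      by auto
    have "norm (S m - S n) < e" if "N \<le> m" "N \<le> n" for m n
      using N[of m n] N[of n m] that \<open>e > 0\<close> by (cases "m \<le> n") (auto simp: norm_minus_commute)
    then show "\<exists>M. \<forall>m\<ge>M. \<forall>n\<ge>M. norm (S m - S n) < e" by blast
  qed
qed

lemma cauchy_criterion_iff_Cauchy:
  "cauchy_criterion a \<longleftrightarrow> Cauchy (\<lambda>n. \<Sum>i<n. a i)"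
proof -
  have "(\<Sum>i=m..<n. a i) = (\<Sum>i<n. a i) - (\<Sum>i<m. a i)" if "m \<le> n" for m n
    using sum_diff_nat_ivl[of 0 m n a] that by (simp add: lessThan_atLeast0)
  then show ?thesis
    unfolding cauchy_criterion_def Cauchy_iff_norm_diff_le by simp
qed

text \<open>By telescoping, every sequence \<open>x\<close> is, up to the constant
  \<open>x 0\<close>, the sequence of partial sums of its increments, so series and sequences carry
  the same information.\<close>

lemma Cauchy_series_summable_iff_complete:
  "(\<forall>a :: nat \<Rightarrow> 'a::real_normed_vector. cauchy_criterion a \<longrightarrow> summable a)
    \<longleftrightarrow> (\<forall>x :: nat \<Rightarrow> 'a. Cauchy x \<longrightarrow> convergent x)" (is "?S \<longleftrightarrow> ?C")
proof
  assume S: ?S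
  show ?C
  proof (intro allI impI)
    fix x :: "nat \<Rightarrow> 'a"
    assume "Cauchy x"
    then have "Cauchy (\<lambda>n. x n - x 0)"
      by (simp add: Cauchy_iff_norm_diff_le)
    then have "summable (\<lambda>n. x (Suc n) - x n)"
      using S by (simp add: cauchy_criterion_iff_Cauchy sum_lessThan_telescope)
    then have "convergent (\<lambda>n. x n - x 0)"
      by (simp add: summable_iff_convergent sum_lessThan_telescope)
    then show "convergent x"
      by (simp add: convergent_diff_const_right_iff)
  qed
qed (simp add: cauchy_criterion_iff_Cauchy summable_iff_convergent)

lemma additive_normed_cat_simps [simp]:
  "Obj additive_normed_cat = UNIV"
  "Arr additive_normed_cat = UNIV"
  "Hom additive_normed_cat x y = UNIV"
  "Idt additive_normed_cat x = 0"
  "Comp additive_normed_cat b a = b + a"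
  "Nrm additive_normed_cat a = ennreal (norm a)"
  by (auto simp: additive_normed_cat_def Hom_def)

lemma additive_is_sequence_iff:
  fixes s :: "nat \<Rightarrow> nat \<Rightarrow> 'a::real_normed_vector"
  shows "is_sequence additive_normed_cat X s \<longleftrightarrow>
    (\<forall>n. s n n = 0) \<and> (\<forall>m n. m \<le> n \<longrightarrow> s m n = s 0 n - s 0 m)"
proof -
  have "(\<forall>k m n. k \<le> m \<longrightarrow> m \<le> n \<longrightarrow> s m n + s k m = s k n)
    \<longleftrightarrow> (\<forall>m n. m \<le> n \<longrightarrow> s m n = s 0 n - s 0 m)" (is "?F \<longleftrightarrow> ?D")
  proof
    assume ?F
    show ?D
    proof (intro allI impI)
      fix m n :: nat
      assume "m \<le> n"
      \<comment> \<open>Functoriality for the chain \<open>0 \<le> m \<le> n\<close>.\<close>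
      with \<open>?F\<close> have "s m n + s 0 m = s 0 n" by blast
      then show "s m n = s 0 n - s 0 m" by (simp add: eq_diff_eq)
    qed
  next
    assume ?D
    show ?F
    proof (intro allI impI)
      fix k m n :: nat
      assume "k \<le> m" "m \<le> n"
      with \<open>?D\<close> have "s m n = s 0 n - s 0 m" "s k m = s 0 m - s 0 k" "s k n = s 0 n - s 0 k"
        by (blast intro: order_trans)+
      then show "s m n + s k m = s k n" by simp
    qed
  qed
  then show ?thesis
    unfolding is_sequence_def by simp
qed

lemma additive_cauchy_sequence_iff:
  fixes s :: "nat \<Rightarrow> nat \<Rightarrow> 'a::real_normed_vector"
  shows "cauchy_sequence additive_normed_cat X s \<longleftrightarrow>
    is_sequence additive_normed_cat X s \<and> Cauchy (s 0)"
proof (cases "is_sequence additive_normed_cat X s")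
  case True
  then have diff: "s m n = s 0 n - s 0 m" if "m \<le> n" for m n
    using that unfolding additive_is_sequence_iff by blast
  \<comment> \<open>Stated at the level of norms: the right-hand side of \<open>diff\<close>
    contains instances of its own left-hand side, whereas rewriting with this equivalence stops
    after one use.\<close>
  have "norm (s m n) \<le> e \<longleftrightarrow> norm (s 0 n - s 0 m) \<le> e" if "m \<le> n" for m n e
    by (subst diff[OF that]) (rule refl)
  then have "(\<forall>p \<in> {(m, n). N \<le> m \<and> m \<le> n}. norm (case p of (m, n) \<Rightarrow> s m n) \<le> e)
    \<longleftrightarrow> (\<forall>m n. N \<le> m \<longrightarrow> m \<le> n \<longrightarrow> norm (s 0 n - s 0 m) \<le> e)" for N e
    by auto
  with True show ?thesis
    unfolding cauchy_sequence_def INF_SUP_eq_0_iff Cauchy_iff_norm_diff_le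
    by (simp add: split_beta ennreal_le_iff order_less_imp_le)
qed (simp add: cauchy_sequence_def)

lemma additive_is_colimit_iff_is_cocone:
  fixes s :: "nat \<Rightarrow> nat \<Rightarrow> 'a::real_normed_vector"
  shows "is_colimit additive_normed_cat X s x \<gamma> \<longleftrightarrow> is_cocone additive_normed_cat X s x \<gamma>"
proof -
  have "\<exists>!f. \<forall>n. f + \<gamma> n = \<delta> n"
    if \<gamma>: "\<forall>m n. m \<le> n \<longrightarrow> \<gamma> n + s m n = \<gamma> m"
      and \<delta>: "\<forall>m n. m \<le> n \<longrightarrow> \<delta> n + s m n = \<delta> m" for \<delta>
  \<comment> \<open>The equation at \<open>n = 0\<close> forces this witness. It works for every
    \<open>n\<close> because both cocones differ from their value at 0 by the same vector
    \<open>s 0 n\<close>, which cancels in the difference.\<close>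
  proof (rule ex1I[of _ "\<delta> 0 - \<gamma> 0"])
    have "\<gamma> n + s 0 n = \<gamma> 0" "\<delta> n + s 0 n = \<delta> 0" for n using \<gamma> \<delta> by auto
    then have "\<delta> 0 - \<gamma> 0 = \<delta> n - \<gamma> n" for n by (metis add_diff_cancel_right)
    then show "\<forall>n. \<delta> 0 - \<gamma> 0 + \<gamma> n = \<delta> n" by (metis diff_add_cancel)
  qed (metis add_diff_cancel_right')
  then have "\<exists>!f. f \<in> Hom additive_normed_cat x y \<and> (\<forall>n. Comp additive_normed_cat f (\<gamma> n) = \<delta> n)"
    if "is_cocone additive_normed_cat X s x \<gamma>" "is_cocone additive_normed_cat X s y \<delta>" for y \<delta>
    using that by (simp add: is_cocone_def)
  then show ?thesis
    unfolding is_colimit_def by blast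
qed

lemma additive_is_normed_colimit_iff:
  fixes s :: "nat \<Rightarrow> nat \<Rightarrow> 'a::real_normed_vector"
  shows "is_normed_colimit additive_normed_cat X s x \<gamma> \<longleftrightarrow>
    is_cocone additive_normed_cat X s x \<gamma> \<and> \<gamma> \<longlonglongrightarrow> 0"
proof -
  have "(\<forall>f. ennreal (norm f) = (INF N. SUP n \<in> {N..}. ennreal (norm (f + \<gamma> n))))
    \<longleftrightarrow> \<gamma> \<longlonglongrightarrow> 0" (is "?L \<longleftrightarrow> _")
  proof
    assume ?L
    from this[rule_format, of 0]
    have "(INF N. SUP n \<in> {N..}. ennreal (norm (\<gamma> n))) = 0" by simp
    then have *: "\<exists>N. \<forall>n\<ge>N. norm (\<gamma> n) \<le> e" if "e > 0" for e
      unfolding INF_SUP_eq_0_iff using that by (simp add: Ball_def)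
    show "\<gamma> \<longlonglongrightarrow> 0"
    proof (rule LIMSEQ_I)
      fix r :: real
      assume "r > 0"
      with *[of "r / 2"] obtain N where N: "norm (\<gamma> n) \<le> r / 2" if "n \<ge> N" for n by auto
      have "norm (\<gamma> n - 0) < r" if "n \<ge> N" for n using N[OF that] \<open>r > 0\<close> by simp
      then show "\<exists>no. \<forall>n\<ge>no. norm (\<gamma> n - 0) < r" by blast
    qed
  next
    assume "\<gamma> \<longlonglongrightarrow> 0"
    show ?L
    proof
      fix f
      have "(\<lambda>n. f + \<gamma> n) \<longlonglongrightarrow> f" using tendsto_add[OF tendsto_const \<open>\<gamma> \<longlonglongrightarrow> 0\<close>, of f] by simp
      then have "(\<lambda>n. ennreal (norm (f + \<gamma> n))) \<longlonglongrightarrow> ennreal (norm f)"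
        by (intro tendsto_ennrealI tendsto_norm)
      \<comment> \<open>The infimum of suprema over tails is a limsup, and for a convergent sequence
        the limsup is the limit.\<close>
      then have "limsup (\<lambda>n. ennreal (norm (f + \<gamma> n))) = ennreal (norm f)"
        by (intro lim_imp_Limsup) auto
      then show "ennreal (norm f) = (INF N. SUP n \<in> {N..}. ennreal (norm (f + \<gamma> n)))"
        by (simp add: limsup_INF_SUP)
    qed
  qed
  then show ?thesis
    unfolding is_normed_colimit_def additive_is_colimit_iff_is_cocone by simp
qed

lemma additive_ex_normed_colimit_iff:
  fixes s :: "nat \<Rightarrow> nat \<Rightarrow> 'a::real_normed_vector"
  assumes "is_sequence additive_normed_cat X s"
  shows "(\<exists>x \<gamma>. is_normed_colimit additive_normed_cat X s x \<gamma>) \<longleftrightarrow> convergent (s 0)"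
proof
  assume "\<exists>x \<gamma>. is_normed_colimit additive_normed_cat X s x \<gamma>"
  then obtain \<gamma> where "\<gamma> n + s 0 n = \<gamma> 0" and "\<gamma> \<longlonglongrightarrow> 0" for n
    by (auto simp: additive_is_normed_colimit_iff is_cocone_def)
  then have "s 0 = (\<lambda>n. \<gamma> 0 - \<gamma> n)" by (metis add_diff_cancel_left')
  moreover have "(\<lambda>n. \<gamma> 0 - \<gamma> n) \<longlonglongrightarrow> \<gamma> 0"
    using tendsto_diff[OF tendsto_const \<open>\<gamma> \<longlonglongrightarrow> 0\<close>, of "\<gamma> 0"] by simp
  ultimately show "convergent (s 0)" by (metis convergentI)
next
  assume "convergent (s 0)"
  then obtain L where "s 0 \<longlonglongrightarrow> L" by (auto simp: convergent_def)
  \<comment> \<open>Every cocone has the form \<open>c - s 0 n\<close> with a constant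
    \<open>c\<close>; tending to 0 forces \<open>c = L\<close>.\<close>
  then have "(\<lambda>n. L - s 0 n) \<longlonglongrightarrow> 0"
    using tendsto_diff[OF tendsto_const, of "s 0" L _ L] by simp
  have "L - s 0 n + s m n = L - s 0 m" if "m \<le> n" for m n
  proof -
    have "s m n = s 0 n - s 0 m"
      using assms that unfolding additive_is_sequence_iff by blast
    then show ?thesis by simp
  qed
  then have "is_cocone additive_normed_cat X s () (\<lambda>n. L - s 0 n)"
    by (simp add: is_cocone_def)
  with \<open>(\<lambda>n. L - s 0 n) \<longlonglongrightarrow> 0\<close>
  have "is_normed_colimit additive_normed_cat X s () (\<lambda>n. L - s 0 n)"
    by (simp add: additive_is_normed_colimit_iff)
  then show "\<exists>x \<gamma>. is_normed_colimit additive_normed_cat X s x \<gamma>" by blast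
qed

lemma additive_cauchy_cocomplete_iff_complete:
  "cauchy_cocomplete (additive_normed_cat :: (unit, 'a::real_normed_vector) normed_cat)
    \<longleftrightarrow> (\<forall>x :: nat \<Rightarrow> 'a. Cauchy x \<longrightarrow> convergent x)" (is "?A \<longleftrightarrow> ?C")
proof
  assume A: ?A
  show ?C
  proof (intro allI impI)
    fix x :: "nat \<Rightarrow> 'a"
    assume "Cauchy x"
    \<comment> \<open>The functor of increments of \<open>x\<close>. Its partial compositions
      \<open>s 0\<close> are \<open>x\<close> translated by \<open>- x 0\<close>, which affects
      neither the Cauchy property nor convergence.\<close>
    define s where "s m n = x n - x m" for m n
    have s: "is_sequence additive_normed_cat (\<lambda>_. ()) s"
      by (simp add: additive_is_sequence_iff s_def)
    have "Cauchy (s 0)" using \<open>Cauchy x\<close> by (simp add: Cauchy_iff_norm_diff_le s_def)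
    then have "convergent (s 0)"
      using A s additive_ex_normed_colimit_iff[OF s]
      by (auto simp: cauchy_cocomplete_def additive_cauchy_sequence_iff)
    then have "convergent (\<lambda>n. x n - x 0)" by (simp add: s_def[abs_def])
    then show "convergent x" by (simp add: convergent_diff_const_right_iff)
  qed
next
  assume ?C
  then show ?A
    unfolding cauchy_cocomplete_def additive_cauchy_sequence_iff
    using additive_ex_normed_colimit_iff by blast
qed

theorem theorem6p8:
  shows "(cauchy_cocomplete (additive_normed_cat :: (unit, 'a::real_normed_vector) normed_cat)
            \<longleftrightarrow> (\<forall>a :: nat \<Rightarrow> 'a. cauchy_criterion a \<longrightarrow> summable a))
       \<and> ((\<forall>a :: nat \<Rightarrow> 'a. cauchy_criterion a \<longrightarrow> summable a)
            \<longleftrightarrow> (\<forall>x :: nat \<Rightarrow> 'a. Cauchy x \<longrightarrow> convergent x))"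
  \<comment> \<open>Cocompleteness and summability are each equivalent to completeness, hence to
    each other.\<close>
  using additive_cauchy_cocomplete_iff_complete Cauchy_series_summable_iff_complete by blast

end
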